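(* Let $Q\in\mathcal{S}_o^n$, $K,L\in\mathcal{K}_o^n$, and let $p,q\in\mathbb{R}$ with $q<p$, $p\ne0$ and $q\ne0$. Then $$\left(\frac{\widetilde{V}_{p,q}(K,L,Q)}{\widetilde{V}_q(K,Q)}\right)^{\frac1p}\ge\left(\frac{\widetilde{V}_q(L,Q)}{\widetilde{V}_q(K,Q)}\right)^{\frac1q},$$ with equality if and only if $K$ and $L$ are dilates.
   Context: $S^{n-1}$ is the unit sphere of $\mathbb{R}^n$ and $du$ is spherical Lebesgue measure. $\mathcal{K}_o^n$ is the set of convex bodies (compact convex sets with non-empty interior) in $\mathbb{R}^n$ containing the origin in their interiors. $\mathcal{S}_o^n$ is the set of star bodies (compact sets, star-shaped with respect to the origin, with continuous radial function) in $\mathbb{R}^n$ containing the origin in their interiors. The radial function is $\rho_Q(u)=\max\{\lambda\ge 0:\lambda u\in Q\}$, $u\in S^{n-1}$, and the support function is $h_K(v)=\max\{v\cdot x:x\in K\}$. $K$ and $L$ are dilates if $K=\lambda L$ for some $\lambda>0$. For $q\in\mathbb{R}$ and $K,Q\in\mathcal{S}_o^n$, the $q$-th dual mixed volume is $\widetilde{V}_q(K,Q)=\frac1n\int_{S^{n-1}}\rho_K^q(u)\rho_Q^{n-q}(u)\,du$. For $K\in\mathcal{K}_o^n$ and a Borel set $\eta\subseteq S^{n-1}$, $\boldsymbol{\alpha}^*_K(\eta)$ is the set of $u\in S^{n-1}$ such that some $v\in\eta$ is an outer unit normal of $K$ at $\rho_K(u)u$, i.e. $\rho_K(u)u\cdot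 v=h_K(v)$. Put $\widetilde{C}_q(K,Q,\eta)=\frac1n\int_{\boldsymbol{\alpha}^*_K(\eta)}\rho_K^q(u)\rho_Q^{n-q}(u)\,du$ and $d\widetilde{C}_{p,q}(K,Q,\cdot)=h_K^{-p}\,d\widetilde{C}_q(K,Q,\cdot)$. The $L_p$ dual mixed volume is $\widetilde{V}_{p,q}(K,L,Q)=\int_{S^{n-1}}h_L^p(v)\,d\widetilde{C}_{p,q}(K,Q,v)$. *)

theory Defs
  imports "HOL-Analysis.Analysis"
begin

text \<open>Euclidean \<open>n\<close>-space is a type \<open>'a\<close> of class \<^class>\<open>euclidean_space\<close>, with \<open>n = DIM('a)\<close>.\<close>

text \<open>
  Suprema stand for maxima: for the compact sets with \<open>0\<close> in the interior used below
  the supremum is attained.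
\<close>

definition radial_fun :: "'a::euclidean_space set \<Rightarrow> 'a \<Rightarrow> real" where
  "radial_fun Q u = Sup {r. 0 \<le> r \<and> r *\<^sub>R u \<in> Q}"

definition support_fun :: "'a::euclidean_space set \<Rightarrow> 'a \<Rightarrow> real" where
  "support_fun K v = (SUP x\<in>K. v \<bullet> x)"

definition convex_bodies_o :: "'a::euclidean_space set set" where
  "convex_bodies_o = {K. compact K \<and> convex K \<and> 0 \<in> interior K}"

definition star_bodies_o :: "'a::euclidean_space set set" where
  "star_bodies_o = {Q. compact Q \<and> (\<forall>x\<in>Q. closed_segment 0 x \<subseteq> Q) \<and>
     continuous_on (sphere 0 1) (radial_fun Q) \<and> 0 \<in> interior Q}"

definition dilates :: "'a::euclidean_space set \<Rightarrow> 'a set \<Rightarrow> bool" where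
  "dilates K L \<longleftrightarrow> (\<exists>c>0. K = (\<lambda>x. c *\<^sub>R x) ` L)"

text \<open>
  Spherical Lebesgue measure by polar coordinates: the measure of \<open>A\<close> is \<open>n\<close> times the
  volume of the cone over \<open>A\<close> (see the lemma below). It is completed because
  \<open>reverse_radial_gauss_image K \<eta>\<close> need not be Borel for Borel \<open>\<eta>\<close>, only Lebesgue measurable.
\<close>

definition spherical_lebesgue :: "'a::euclidean_space measure" where
  "spherical_lebesgue = completion (scale_measure (of_nat DIM('a))
     (distr (restrict_space lborel (ball 0 1 - {0})) (restrict_space borel (sphere 0 1)) sgn))"

lemma emeasure_spherical_lebesgue:
  fixes A :: "'a::euclidean_space set"
  assumes "A \<in> sets borel" "A \<subseteq> sphere 0 1"
  shows "emeasure spherical_lebesgue A =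
    of_nat DIM('a) * emeasure lborel {r *\<^sub>R u | r u. 0 < r \<and> r < 1 \<and> u \<in> A}"
proof -
  let ?R = "restrict_space (lborel :: 'a measure) (ball 0 1 - {0})"
  let ?S = "restrict_space (borel :: 'a measure) (sphere 0 1)"
  have A: "A \<in> sets ?S"
    using assms by (auto simp: sets_restrict_space_iff)
  have sgn: "sgn \<in> measurable ?R ?S"
  proof (rule measurable_restrict_space2)
    show "sgn \<in> space ?R \<rightarrow> sphere 0 1"
      by (auto simp: space_restrict_space norm_sgn)
    show "sgn \<in> borel_measurable ?R"
      unfolding sgn_div_norm by (rule measurable_restrict_space1) measurable
  qed
  have cone: "sgn -` A \<inter> space ?R = {r *\<^sub>R u | r u. 0 < r \<and> r < 1 \<and> u \<in> A}" (is "?L = ?C")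
  proof (intro equalityI subsetI)
    fix x assume "x \<in> ?L"
    then have "x = norm x *\<^sub>R sgn x" "0 < norm x" "norm x < 1" "sgn x \<in> A"
      by (auto simp: space_restrict_space sgn_div_norm)
    then show "x \<in> ?C" by blast
  next
    fix x assume "x \<in> ?C"
    then obtain r u where x: "x = r *\<^sub>R u" "0 < r" "r < 1" "u \<in> A" by blast
    then have "norm u = 1" using assms(2) by auto
    with x show "x \<in> ?L"
      by (auto simp: space_restrict_space sgn_div_norm)
  qed
  have "emeasure spherical_lebesgue A = of_nat DIM('a) * emeasure ?R (sgn -` A \<inter> space ?R)"
    unfolding spherical_lebesgue_def using A sgn by (simp add: emeasure_distr)
  also have "emeasure ?R (sgn -` A \<inter> space ?R) = emeasure lborel (sgn -` A \<inter> space ?R)"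
    by (rule emeasure_restrict_space) (auto simp: space_restrict_space)
  finally show ?thesis unfolding cone .
qed

definition dual_mixed_volume :: "real \<Rightarrow> 'a::euclidean_space set \<Rightarrow> 'a set \<Rightarrow> real" where
  "dual_mixed_volume q K Q = (1 / real DIM('a)) *
     (LINT u|spherical_lebesgue. radial_fun K u powr q * radial_fun Q u powr (real DIM('a) - q))"

definition reverse_radial_gauss_image :: "'a::euclidean_space set \<Rightarrow> 'a set \<Rightarrow> 'a set" where
  "reverse_radial_gauss_image K \<eta> =
     {u \<in> sphere 0 1. \<exists>v\<in>\<eta>. (radial_fun K u *\<^sub>R u) \<bullet> v = support_fun K v}"

definition dual_curvature :: "real \<Rightarrow> 'a::euclidean_space set \<Rightarrow> 'a set \<Rightarrow> 'a set \<Rightarrow> real" where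
  "dual_curvature q K Q \<eta> = (1 / real DIM('a)) *
     (LINT u:reverse_radial_gauss_image K \<eta>|spherical_lebesgue.
        radial_fun K u powr q * radial_fun Q u powr (real DIM('a) - q))"

text \<open>
  \<^const>\<open>measure_of\<close> yields the null measure if the given set function is not countably additive.
  For a convex body \<open>K\<close> and a star body \<open>Q\<close> the set function \<open>dual_curvature q K Q\<close> is
  countably additive, since almost all boundary points of \<open>K\<close> have a unique outer unit normal.
\<close>

definition dual_curvature_measure :: "real \<Rightarrow> 'a::euclidean_space set \<Rightarrow> 'a set \<Rightarrow> 'a measure" where
  "dual_curvature_measure q K Q =
     measure_of (sphere 0 1) (sets (restrict_space borel (sphere 0 1)))
       (\<lambda>\<eta>. ennreal (dual_curvature q K Q \<eta>))"

definition Lp_dual_curvature_measure ::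
  "real \<Rightarrow> real \<Rightarrow> 'a::euclidean_space set \<Rightarrow> 'a set \<Rightarrow> 'a measure" where
  "Lp_dual_curvature_measure p q K Q =
     density (dual_curvature_measure q K Q) (\<lambda>v. ennreal (support_fun K v powr (- p)))"

definition Lp_dual_mixed_volume ::
  "real \<Rightarrow> real \<Rightarrow> 'a::euclidean_space set \<Rightarrow> 'a set \<Rightarrow> 'a set \<Rightarrow> real" where
  "Lp_dual_mixed_volume p q K L Q =
     (LINT v|Lp_dual_curvature_measure p q K Q. support_fun L v powr p)"

end

theory Submission
  imports Defs
begin

text \<open>
  For a direction \<open>u\<close> let \<open>v\<close> be an outer unit normal of \<open>K\<close> at the boundary point in direction \<open>u\<close>.
  The support value of \<open>K\<close> at \<open>v\<close> is \<open>radial_fun K u * (u \<bullet> v)\<close>, and that of \<open>L\<close> is at least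
  \<open>radial_fun L u * (u \<bullet> v)\<close>. Hence the ratio of support functions
  \<open>f u = support_fun L v / support_fun K v\<close> dominates the ratio of radial functions
  \<open>g u = radial_fun L u / radial_fun K u\<close> (lemma \<open>radial_ratio_le_support_ratio\<close>).

  Weight the spherical measure by the integrand of the dual mixed volume of \<open>K\<close> and \<open>Q\<close> and
  normalise. The right-hand side of the inequality is then the \<open>q\<close>-th power mean of \<open>g\<close>, and the
  left-hand side is the \<open>p\<close>-th power mean of \<open>f\<close>. Since \<open>g \<le> f\<close> and power means increase strictly
  with the exponent unless the function is constant (lemma \<open>powr_mean_le\<close>), the inequality follows.
  In the equality case \<open>g\<close> is constant almost everywhere, hence everywhere by continuity, which says
  that \<open>K\<close> and \<open>L\<close> are dilates.

  The analytic part is the formula for the left-hand side: the dual curvature measure has to be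
  recognised as the image of the weighted spherical measure under a selection of normals
  (lemma \<open>dual_curvature_measure_eq_distr\<close>). This depends on the normal being unique in almost every
  direction. Scaled normals are maximisers of the functional \<open>w \<mapsto> w \<bullet> u\<close> over the polar body, and
  over any compact set such maximisers are unique for almost all functionals
  (lemma \<open>nonunique_linear_maximisers_null\<close>), by monotonicity along lines and Fubini's theorem.
\<close>

text \<open>
  Both sides vanish at \<open>t = 1\<close>, and \<open>t powr (p - 1) - t powr (q - 1)\<close>, the derivative of the
  difference, has the sign of \<open>t - 1\<close>. Dividing by the exponents makes one inequality cover all
  sign patterns of \<open>p\<close> and \<open>q\<close>.
\<close>
section \<open>A power mean inequality with its equality case\<close>
lemma power_mean_gap:
  fixes p q t :: real
  assumes "q < p" "p \<noteq> 0" "q \<noteq> 0" "0 < t"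
  shows "(t powr q - 1) / q \<le> (t powr p - 1) / p"
    and "(t powr p - 1) / p = (t powr q - 1) / q \<longleftrightarrow> t = 1"
proof -
  define \<phi> where "\<phi> s = (s powr p - 1) / p - (s powr q - 1) / q" for s :: real
  have deriv: "(\<phi> has_real_derivative s powr (p - 1) - s powr (q - 1)) (at s)" if "0 < s" for s
    unfolding \<phi>_def using that assms by (auto intro!: derivative_eq_intros)
  have pos: "0 < \<phi> t" if "t \<noteq> 1"
  proof (cases "t < 1")
    case True
    obtain z where z: "t < z" "z < 1" "\<phi> 1 - \<phi> t = (1 - t) * (z powr (p - 1) - z powr (q - 1))"
      using MVT2[of t 1 \<phi> "\<lambda>s. s powr (p - 1) - s powr (q - 1)"] True deriv assms(4) by force
    have "z powr (p - 1) < z powr (q - 1)"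
      using z assms by (intro powr_less_mono') auto
    then have "(1 - t) * (z powr (p - 1) - z powr (q - 1)) < 0"
      using True by (intro mult_pos_neg) auto
    with z(3) show ?thesis by (simp add: \<phi>_def)
  next
    case False
    then have "1 < t" using that by simp
    then obtain z where z: "1 < z" "z < t" "\<phi> t - \<phi> 1 = (t - 1) * (z powr (p - 1) - z powr (q - 1))"
      using MVT2[of 1 t \<phi> "\<lambda>s. s powr (p - 1) - s powr (q - 1)"] deriv by force
    have "z powr (q - 1) < z powr (p - 1)"
      using z assms by (intro powr_less_mono) auto
    then have "(t - 1) * (z powr (p - 1) - z powr (q - 1)) > 0"
      using \<open>1 < t\<close> by simp
    with z(3) show ?thesis by (simp add: \<phi>_def)
  qed
  have one: "\<phi> 1 = 0" by (simp add: \<phi>_def)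
  show "(t powr q - 1) / q \<le> (t powr p - 1) / p"
    using pos one by (cases "t = 1") (auto simp: \<phi>_def)
  show "(t powr p - 1) / p = (t powr q - 1) / q \<longleftrightarrow> t = 1"
    using pos one by (cases "t = 1") (auto simp: \<phi>_def)
qed

lemma powr_div_exponent_mono:
  fixes x y p :: real
  assumes "0 < x" "x \<le> y"
  shows "x powr p / p \<le> y powr p / p"
proof (cases "0 \<le> p")
  case True
  then show ?thesis using assms by (intro divide_right_mono powr_mono2) auto
next
  case False
  then show ?thesis using assms by (intro divide_right_mono_neg powr_mono2') auto
qed

text \<open>
  With \<open>B\<close> the \<open>q\<close>-th power mean of \<open>g\<close>, the function \<open>(g / B) powr q - 1\<close> has integral \<open>0\<close>.
  Integrating the pointwise inequality for \<open>t = g x / B\<close> therefore bounds the \<open>p\<close>-th power mean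
  of \<open>g\<close>, and a fortiori that of \<open>f\<close>, from below by \<open>B\<close>. If the two means agree, then the integral
  of the nonnegative pointwise gap is \<open>0\<close>, so the gap vanishes almost everywhere and \<open>g\<close> is
  almost everywhere equal to \<open>B\<close>.
\<close>
lemma powr_mean_le:
  fixes M :: "'b measure" and f g :: "'b \<Rightarrow> real" and p q :: real
  assumes "finite_measure M" and V: "0 < measure M (space M)"
    and "q < p" "p \<noteq> 0" "q \<noteq> 0"
    and g: "\<And>x. x \<in> space M \<Longrightarrow> 0 < g x" and fg: "\<And>x. x \<in> space M \<Longrightarrow> g x \<le> f x"
    and intf: "integrable M (\<lambda>x. f x powr p)" and intg: "integrable M (\<lambda>x. g x powr q)"
      and intgp: "integrable M (\<lambda>x. g x powr p)"
  defines "A \<equiv> ((LINT x|M. f x powr p) / measure M (space M)) powr (1 / p)"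
    and "B \<equiv> ((LINT x|M. g x powr q) / measure M (space M)) powr (1 / q)"
  shows "B \<le> A" and "A = B \<Longrightarrow> AE x in M. g x = B"
proof -
  interpret finite_measure M by fact
  define V where "V = measure M (space M)"
  have pos_int: "0 < (LINT x|M. h x powr r)"
    if "integrable M (\<lambda>x. h x powr r)" "\<And>x. x \<in> space M \<Longrightarrow> 0 < h x" for h :: "'b \<Rightarrow> real" and r
  proof -
    have "(LINT x|M. h x powr r) \<noteq> 0"
    proof
      assume "(LINT x|M. h x powr r) = 0"
      then have "AE x in M. h x powr r = 0"
        using integral_nonneg_eq_0_iff_AE[OF that(1)] by auto
      then have "AE x in M. False"
        by (rule AE_mp) (use that(2) in \<open>auto intro!: AE_I2 dest!: that(2)\<close>)
      then have "emeasure M (space M) = 0" by (simp add: eventually_False ae_filter_eq_bot_iff)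
      then show False using V by (simp add: measure_def)
    qed
    moreover have "0 \<le> (LINT x|M. h x powr r)" by (intro Bochner_Integration.integral_nonneg) auto
    ultimately show ?thesis by linarith
  qed
  have f: "0 < f x" if "x \<in> space M" for x using g[OF that] fg[OF that] by simp
  have Ig: "0 < (LINT x|M. g x powr q)" by (rule pos_int[OF intg g])
  have If: "0 < (LINT x|M. f x powr p)" by (rule pos_int[OF intf f])
  have A: "0 < A" unfolding A_def using If V by simp
  have B: "0 < B" unfolding B_def using Ig V by simp
  have Ap: "(LINT x|M. f x powr p) = V * A powr p"
    unfolding A_def using If V assms(4) by (simp add: powr_powr V_def)
  have Bq: "(LINT x|M. g x powr q) = V * B powr q"
    unfolding B_def using Ig V assms(5) by (simp add: powr_powr V_def)
  \<comment> \<open>\<open>d\<close> is the gap from comparing the exponents, \<open>e\<close> the gap from comparing \<open>f\<close> with \<open>g\<close>.\<close>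
  define d where "d x = ((g x / B) powr p - 1) / p - ((g x / B) powr q - 1) / q" for x
  define e where "e x = ((f x / B) powr p - 1) / p - ((g x / B) powr p - 1) / p" for x
  have d0: "0 \<le> d x" and d_eq: "d x = 0 \<longleftrightarrow> g x = B" if "x \<in> space M" for x
    using power_mean_gap[OF assms(3-5), of "g x / B"] g[OF that] B by (auto simp: d_def)
  have e0: "0 \<le> e x" if "x \<in> space M" for x
  proof -
    have "(g x / B) powr p / p \<le> (f x / B) powr p / p"
      using g[OF that] fg[OF that] B by (intro powr_div_exponent_mono divide_right_mono) auto
    then show ?thesis by (simp add: e_def diff_divide_distrib)
  qed
  have scaled: "(h x / B) powr r = h x powr r / B powr r" if "0 < h x" for h :: "'b \<Rightarrow> real" and r x
    using that B by (simp add: powr_divide)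
  have isc: "integrable M (\<lambda>x. (h x / B) powr r)"
    if "\<And>x. x \<in> space M \<Longrightarrow> 0 < h x" "integrable M (\<lambda>x. h x powr r)" for h :: "'b \<Rightarrow> real" and r
  proof -
    have "integrable M (\<lambda>x. (h x / B) powr r) \<longleftrightarrow> integrable M (\<lambda>x. h x powr r / B powr r)"
      using that(1) by (intro Bochner_Integration.integrable_cong refl scaled)
    then show ?thesis using that(2) by simp
  qed
  have isc': "(LINT x|M. (h x / B) powr r) = (LINT x|M. h x powr r) / B powr r"
    if "\<And>x. x \<in> space M \<Longrightarrow> 0 < h x" for h :: "'b \<Rightarrow> real" and r
  proof -
    have "(LINT x|M. (h x / B) powr r) = (LINT x|M. h x powr r / B powr r)"
      using that by (intro Bochner_Integration.integral_cong refl scaled)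
    then show ?thesis by simp
  qed
  note [simp] = isc[OF g intg] isc[OF g intgp] isc[OF f intf]
  have int_d: "integrable M d" and int_e: "integrable M e" unfolding d_def e_def by simp_all
  have "(LINT x|M. d x + e x) = (LINT x|M. ((f x / B) powr p - 1) / p - ((g x / B) powr q - 1) / q)"
    by (simp add: d_def e_def)
  also have "\<dots> = ((LINT x|M. (f x / B) powr p) - V) / p - ((LINT x|M. (g x / B) powr q) - V) / q"
    by (simp add: V_def)
  also have "\<dots> = V * ((A powr p / B powr p - 1) / p)"
    using B by (simp add: isc'[OF g] isc'[OF f] Ap Bq algebra_simps)
  finally have total: "(LINT x|M. d x + e x) = V * ((A / B) powr p - 1) / p"
    using A B by (simp add: powr_divide)
  have nonneg: "0 \<le> (LINT x|M. d x + e x)"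
    using d0 e0 by (intro Bochner_Integration.integral_nonneg) auto
  then have "0 \<le> ((A / B) powr p - 1) / p"
    using V by (simp add: total V_def zero_le_divide_iff zero_le_mult_iff mult_le_0_iff)
  then show "B \<le> A"
  proof (rule contrapos_pp)
    assume "\<not> B \<le> A"
    then have *: "0 < A / B" "A / B < 1" using A B by auto
    show "\<not> 0 \<le> ((A / B) powr p - 1) / p"
    proof (cases "0 < p")
      case True
      then show ?thesis using powr_less_mono2[OF True _ *(2)] * by (simp add: divide_less_0_iff not_le)
    next
      case False
      then have "p < 0" using assms(4) by simp
      then show ?thesis using powr_less_mono2_neg[OF _ *] by (simp add: divide_less_0_iff not_le)
    qed
  qed
  show "AE x in M. g x = B" if "A = B"
  proof -
    have "(LINT x|M. d x + e x) = 0" using total that B by simp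
    then have "AE x in M. d x + e x = 0"
      using integral_nonneg_eq_0_iff_AE[of M "\<lambda>x. d x + e x"] int_d int_e d0 e0 by (auto intro!: AE_I2 add_nonneg_nonneg)
    then show ?thesis
    proof (rule AE_mp, intro AE_I2 impI)
      fix x assume x: "x \<in> space M" and "d x + e x = 0"
      then have "d x = 0" using d0[OF x] e0[OF x] by linarith
      then show "g x = B" using d_eq[OF x] by simp
    qed
  qed
qed

section \<open>Almost everywhere unique maximisers of linear functionals\<close>

text \<open>
  All translates of \<open>N\<close> along \<open>e\<close> have the same measure. Averaging this measure over translations by
  \<open>t *\<^sub>R e\<close> with \<open>t\<close> in the unit interval and exchanging the integrals leaves one-dimensional
  integrals over countable sets.
\<close>
lemma null_set_if_lines_countable:
  fixes N :: "'a::euclidean_space set"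
  assumes [measurable]: "N \<in> sets borel" and lines: "\<And>x. countable {t. x + t *\<^sub>R e \<in> N}"
  shows "N \<in> null_sets lborel"
proof -
  have shift: "(\<integral>\<^sup>+ x. indicator N (x + t *\<^sub>R e) \<partial>lborel) = emeasure lborel N" for t
  proof -
    have "emeasure lborel N = (\<integral>\<^sup>+ x. indicator N x \<partial>distr lborel borel ((+) (t *\<^sub>R e)))"
      by (simp add: lborel_distr_plus)
    also have "\<dots> = (\<integral>\<^sup>+ x. indicator N (t *\<^sub>R e + x) \<partial>lborel)"
      by (rule nn_integral_distr) auto
    finally show ?thesis by (simp add: add.commute)
  qed
  have "emeasure lborel N = (\<integral>\<^sup>+ t. emeasure lborel N * indicator {0..1::real} t \<partial>lborel)"
    by (simp add: nn_integral_cmult_indicator)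
  also have "\<dots> = (\<integral>\<^sup>+ t. (\<integral>\<^sup>+ x. indicator N (x + t *\<^sub>R e) * indicator {0..1::real} t \<partial>lborel) \<partial>lborel)"
    by (simp add: shift nn_integral_multc)
  also have "\<dots> = (\<integral>\<^sup>+ x. (\<integral>\<^sup>+ t. indicator N (x + t *\<^sub>R e) * indicator {0..1::real} t \<partial>lborel) \<partial>lborel)"
    by (rule lborel_pair.Fubini') measurable
  also have "\<dots> = (\<integral>\<^sup>+ x. 0 \<partial>(lborel :: 'a measure))"
  proof (rule nn_integral_cong)
    fix x :: 'a
    have "AE t in lborel. t \<notin> {t. x + t *\<^sub>R e \<in> N}"
      by (rule AE_not_in) (auto simp: null_sets_def emeasure_lborel_countable[OF lines] intro!: sets.countable lines)
    then show "(\<integral>\<^sup>+ t. indicator N (x + t *\<^sub>R e) * indicator {0..1::real} t \<partial>lborel) = 0"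
      by (subst nn_integral_0_iff_AE) (auto elim!: AE_mp)
  qed
  finally show ?thesis by (simp add: null_sets_def)
qed

definition linear_maximisers :: "'a::euclidean_space set \<Rightarrow> 'a \<Rightarrow> 'a set" where
  "linear_maximisers P x = {w \<in> P. \<forall>w'\<in>P. w' \<bullet> x \<le> w \<bullet> x}"

text \<open>
  The pairs of a maximiser in \<open>C\<close> and its functional form a closed set, which is projected along
  the compact set \<open>P\<close>.
\<close>
lemma closed_linear_maximisers_meet:
  fixes P C :: "'a::euclidean_space set"
  assumes "compact P" "closed C"
  shows "closed {x. linear_maximisers P x \<inter> C \<noteq> {}}"
proof -
  let ?T = "(P \<inter> C) \<times> UNIV \<inter> (\<Inter>w'\<in>P. {z. w' \<bullet> snd z \<le> fst z \<bullet> snd z})"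
  have "closed ?T"
    using assms by (intro closed_Int closed_Times closed_INT ballI closed_Collect_le continuous_intros)
      (auto intro: compact_imp_closed)
  then have "closed {x. \<exists>w. w \<in> P \<and> (w, x) \<in> ?T}"
    by (rule closed_compact_projection[OF assms(1)])
  also have "{x. \<exists>w. w \<in> P \<and> (w, x) \<in> ?T} = {x. linear_maximisers P x \<inter> C \<noteq> {}}"
    by (auto simp: linear_maximisers_def)
  finally show ?thesis .
qed

lemma linear_maximisers_scaleR:
  "0 < r \<Longrightarrow> linear_maximisers P (r *\<^sub>R x) = linear_maximisers P x"
  by (simp add: linear_maximisers_def)

lemma linear_maximisers_monotone:
  assumes "w \<in> linear_maximisers P x" "w' \<in> linear_maximisers P x'"
  shows "0 \<le> (w' - w) \<bullet> (x' - x)"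
  using assms by (fastforce simp: linear_maximisers_def inner_diff_left inner_diff_right)

text \<open>
  If two maximisers differ, some coordinate of them is separated by rationals \<open>a < b\<close>: one is at
  most \<open>a\<close>, the other at least \<open>b\<close>. For fixed \<open>e\<close>, \<open>a\<close>, \<open>b\<close> the set of such \<open>x\<close> is closed, and
  monotonicity of the maximisers along a line parallel to \<open>e\<close> allows at most one such point on it.
  In other terms, the convex function \<open>x \<mapsto> max {w \<bullet> x | w \<in> P}\<close> has partial derivatives almost
  everywhere, and at such points its subgradient is unique.
\<close>
lemma nonunique_linear_maximisers_null:
  fixes P :: "'a::euclidean_space set"
  assumes "compact P"
  shows "{x. \<exists>w\<in>linear_maximisers P x. \<exists>w'\<in>linear_maximisers P x. w \<noteq> w'} \<in> null_sets lborel"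
proof -
  \<comment> \<open>Both conditions are closed, whereas strict separation of two maximisers would not be.\<close>
  define N where "N e a b = {x. linear_maximisers P x \<inter> {w. e \<bullet> w \<le> a} \<noteq> {}} \<inter>
      {x. linear_maximisers P x \<inter> {w. b \<le> e \<bullet> w} \<noteq> {}}" for e :: 'a and a b :: real
  have null: "N e a b \<in> null_sets lborel" if "e \<in> Basis" "a < b" for e a b
  proof (rule null_set_if_lines_countable)
    show "N e a b \<in> sets borel"
      unfolding N_def
      by (intro borel_closed closed_Int closed_linear_maximisers_meet assms closed_Collect_le continuous_intros)
    fix x :: 'a
    have "\<not> s < t" if st: "x + s *\<^sub>R e \<in> N e a b" "x + t *\<^sub>R e \<in> N e a b" for s t
    proof
      assume "s < t"
      obtain w w' where w: "w \<in> linear_maximisers P (x + s *\<^sub>R e)" "b \<le> e \<bullet> w"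
          and w': "w' \<in> linear_maximisers P (x + t *\<^sub>R e)" "e \<bullet> w' \<le> a"
        using st unfolding N_def by blast
      have "0 \<le> (t - s) * ((w' - w) \<bullet> e)"
        using linear_maximisers_monotone[OF w(1) w'(1)] by (simp add: inner_diff_right left_diff_distrib)
      then have "e \<bullet> w \<le> e \<bullet> w'"
        using \<open>s < t\<close> by (simp add: zero_le_mult_iff inner_diff_left inner_diff_right inner_commute)
      then show False using w w' \<open>a < b\<close> by simp
    qed
    then have "s = t" if "x + s *\<^sub>R e \<in> N e a b" "x + t *\<^sub>R e \<in> N e a b" for s t
      using that by (meson linorder_neqE)
    then have "\<exists>c. {t. x + t *\<^sub>R e \<in> N e a b} \<subseteq> {c}" by blast
    then show "countable {t. x + t *\<^sub>R e \<in> N e a b}"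
      by (meson countable_finite finite.emptyI finite_insert finite_subset)
  qed
  have "{x. \<exists>w\<in>linear_maximisers P x. \<exists>w'\<in>linear_maximisers P x. w \<noteq> w'} =
      (\<Union>e\<in>Basis. \<Union>a\<in>\<rat>. \<Union>b\<in>{b\<in>\<rat>. a < b}. N e a b)" (is "?L = ?R")
  proof (intro equalityI subsetI)
    fix x assume "x \<in> ?L"
    then obtain w w' where w: "w \<in> linear_maximisers P x" "w' \<in> linear_maximisers P x" "w \<noteq> w'"
      by blast
    obtain e where e: "e \<in> Basis" "w \<bullet> e \<noteq> w' \<bullet> e"
      using w(3) by (auto simp: euclidean_eq_iff[of w w'])
    have *: "\<exists>a\<in>\<rat>. \<exists>b\<in>{b\<in>\<rat>. a < b}. x \<in> N e a b"
      if uv: "u \<in> linear_maximisers P x" "v \<in> linear_maximisers P x" "u \<bullet> e < v \<bullet> e" for u v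
    proof -
      obtain a where a: "a \<in> \<rat>" "u \<bullet> e < a" "a < v \<bullet> e" using Rats_dense_in_real[OF uv(3)] by blast
      obtain b where b: "b \<in> \<rat>" "a < b" "b < v \<bullet> e" using Rats_dense_in_real[OF a(3)] by blast
      have "x \<in> N e a b" using uv a b by (fastforce simp: N_def inner_commute)
      then show ?thesis using a b by blast
    qed
    show "x \<in> ?R"
      using *[OF w(1,2)] *[OF w(2,1)] e by (cases "w \<bullet> e < w' \<bullet> e") auto
  qed (fastforce simp: N_def)
  also have "\<dots> \<in> null_sets lborel"
    by (intro null_sets_UN' countable_finite finite_Basis countable_rat countable_Collect null) auto
  finally show ?thesis .
qed

section \<open>Radial functions\<close>

text \<open>
  The hypotheses common to convex bodies and star bodies on which the elementary theory of the radial
  function rests. Continuity of the radial function is left out: for convex bodies it is a theorem,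
  proved by means of the facts below.
\<close>
definition star_shaped_body :: "'a::euclidean_space set \<Rightarrow> bool" where
  "star_shaped_body S \<longleftrightarrow> compact S \<and> 0 \<in> interior S \<and> (\<forall>x\<in>S. closed_segment 0 x \<subseteq> S)"

lemma star_shaped_body_convex:
  assumes "K \<in> convex_bodies_o"
  shows "star_shaped_body K"
proof -
  have K: "compact K" "convex K" "0 \<in> interior K" using assms by (auto simp: convex_bodies_o_def)
  then have "0 \<in> K" using interior_subset by blast
  then have "closed_segment 0 x \<subseteq> K" if "x \<in> K" for x
    using that K(2) by (intro closed_segment_subset)
  with K show ?thesis by (simp add: star_shaped_body_def)
qed

lemma star_shaped_body_star: "Q \<in> star_bodies_o \<Longrightarrow> star_shaped_body Q"
  by (simp add: star_shaped_body_def star_bodies_o_def)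

context
  fixes S :: "'a::euclidean_space set" and u :: 'a
  assumes S: "star_shaped_body S" and u: "norm u = 1"
begin

lemma radial_set_compact: "compact {r. 0 \<le> r \<and> r *\<^sub>R u \<in> S}" (is "compact ?R")
proof -
  obtain B where B: "\<And>x. x \<in> S \<Longrightarrow> norm x \<le> B"
    using S by (meson star_shaped_body_def bounded_iff compact_imp_bounded)
  have "?R \<subseteq> {0..B}" using B u by fastforce
  then have "bounded ?R" by (rule bounded_subset[OF bounded_closed_interval])
  moreover have "?R = {0..} \<inter> (\<lambda>r. r *\<^sub>R u) -` S" by auto
  moreover have "closed ((\<lambda>r. r *\<^sub>R u) -` S)"
    using S by (intro continuous_closed_vimage) (auto simp: star_shaped_body_def compact_imp_closed intro!: continuous_intros)
  ultimately show ?thesis by (simp add: compact_eq_bounded_closed closed_Int)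
qed

lemma radial_fun_ge: "0 \<le> r \<Longrightarrow> r *\<^sub>R u \<in> S \<Longrightarrow> r \<le> radial_fun S u"
  unfolding radial_fun_def
  by (rule cSup_upper) (auto intro!: bounded_imp_bdd_above compact_imp_bounded radial_set_compact)

lemma radial_fun_pos: "0 < radial_fun S u"
proof -
  obtain d where d: "0 < d" "cball 0 d \<subseteq> S"
    using S by (auto simp: star_shaped_body_def mem_interior_cball)
  then have "d *\<^sub>R u \<in> S" using u by auto
  then show ?thesis using radial_fun_ge[of d] d by simp
qed

lemma radial_fun_mem: "radial_fun S u *\<^sub>R u \<in> S"
proof -
  have "0 \<in> S" using S interior_subset by (auto simp: star_shaped_body_def)
  then have "{r. 0 \<le> r \<and> r *\<^sub>R u \<in> S} \<noteq> {}" by (auto intro!: exI[of _ 0])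
  then have "radial_fun S u \<in> {r. 0 \<le> r \<and> r *\<^sub>R u \<in> S}"
    unfolding radial_fun_def
    by (intro closed_contains_Sup) (auto intro!: bounded_imp_bdd_above compact_imp_bounded compact_imp_closed radial_set_compact)
  then show ?thesis by simp
qed

lemma radial_fun_mem_iff:
  assumes "0 \<le> r"
  shows "r *\<^sub>R u \<in> S \<longleftrightarrow> r \<le> radial_fun S u"
proof
  assume r: "r \<le> radial_fun S u"
  have "r *\<^sub>R u = (1 - r / radial_fun S u) *\<^sub>R 0 + (r / radial_fun S u) *\<^sub>R (radial_fun S u *\<^sub>R u)"
    using radial_fun_pos by simp
  also have "\<dots> \<in> closed_segment 0 (radial_fun S u *\<^sub>R u)"
    using r assms radial_fun_pos by (auto simp: in_segment intro!: exI[of _ "r / radial_fun S u"])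
  finally show "r *\<^sub>R u \<in> S" using S radial_fun_mem by (auto simp: star_shaped_body_def)
qed (rule radial_fun_ge[OF assms])

end

lemma mem_star_shaped_body_iff:
  assumes "star_shaped_body S"
  shows "x \<in> S \<longleftrightarrow> x = 0 \<or> norm x \<le> radial_fun S (sgn x)"
proof (cases "x = 0")
  case True
  then show ?thesis using assms interior_subset by (auto simp: star_shaped_body_def)
next
  case False
  then have "x = norm x *\<^sub>R sgn x" by (simp add: sgn_div_norm)
  moreover have "norm x *\<^sub>R sgn x \<in> S \<longleftrightarrow> norm x \<le> radial_fun S (sgn x)"
    using False by (intro radial_fun_mem_iff assms) (auto simp: norm_sgn)
  ultimately show ?thesis using False by simp
qed

lemma radial_fun_scaleR:
  assumes S: "star_shaped_body S" and cS: "star_shaped_body ((\<lambda>x. c *\<^sub>R x) ` S)"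
    and u: "norm u = 1" and c: "0 < c"
  shows "radial_fun ((\<lambda>x. c *\<^sub>R x) ` S) u = c * radial_fun S u"
proof -
  have *: "r *\<^sub>R u \<in> (\<lambda>x. c *\<^sub>R x) ` S \<longleftrightarrow> (r / c) *\<^sub>R u \<in> S" for r
  proof
    assume "(r / c) *\<^sub>R u \<in> S"
    then have "c *\<^sub>R ((r / c) *\<^sub>R u) \<in> (\<lambda>x. c *\<^sub>R x) ` S" by (rule imageI)
    then show "r *\<^sub>R u \<in> (\<lambda>x. c *\<^sub>R x) ` S" using c by simp
  next
    assume "r *\<^sub>R u \<in> (\<lambda>x. c *\<^sub>R x) ` S"
    then obtain x where x: "x \<in> S" "r *\<^sub>R u = c *\<^sub>R x" by blast
    have "(r / c) *\<^sub>R u = (1 / c) *\<^sub>R (r *\<^sub>R u)" by simp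
    also have "\<dots> = x" using c by (simp add: x)
    finally show "(r / c) *\<^sub>R u \<in> S" using x by simp
  qed
  have iff: "r \<le> radial_fun ((\<lambda>x. c *\<^sub>R x) ` S) u \<longleftrightarrow> r \<le> c * radial_fun S u" if "0 \<le> r" for r
    using radial_fun_mem_iff[OF cS u that]
      radial_fun_mem_iff[OF S u, of "r / c"] that c *[of r]
    by (simp add: pos_divide_le_eq mult.commute)
  show ?thesis
    using iff[of "c * radial_fun S u"] iff[of "radial_fun ((\<lambda>x. c *\<^sub>R x) ` S) u"]
      radial_fun_pos[OF S u] radial_fun_pos[OF cS u] c by (intro antisym) auto
qed

section \<open>Support functions\<close>

lemma support_fun_ge:
  assumes "compact K" "x \<in> K"
  shows "v \<bullet> x \<le> support_fun K v"
  unfolding support_fun_def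
  by (rule cSUP_upper[OF assms(2)]) (intro bounded_imp_bdd_above compact_imp_bounded compact_continuous_image continuous_intros assms)

lemma support_fun_le:
  assumes "K \<noteq> {}" "\<And>x. x \<in> K \<Longrightarrow> v \<bullet> x \<le> c"
  shows "support_fun K v \<le> c"
  unfolding support_fun_def using assms by (rule cSUP_least)

lemma support_fun_pos:
  assumes "compact K" "0 \<in> interior K" "v \<noteq> 0"
  shows "0 < support_fun K v"
proof -
  obtain d where d: "0 < d" "cball 0 d \<subseteq> K" using assms(2) by (auto simp: mem_interior_cball)
  then have "d *\<^sub>R sgn v \<in> K" by (auto simp: norm_sgn)
  from support_fun_ge[OF assms(1) this, of v] have "d * norm v \<le> support_fun K v"
    by (simp add: sgn_div_norm divide_simps flip: power2_norm_eq_inner) (simp add: power2_eq_square split: if_splits)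
  then show ?thesis using d assms(3) by (smt (verit) mult_pos_pos zero_less_norm_iff)
qed

lemma continuous_on_support_fun:
  assumes "compact K" "K \<noteq> {}"
  shows "continuous_on T (support_fun K)"
proof -
  have "convex_on UNIV (support_fun K)"
  proof (rule convex_onI)
    fix t :: real and x y :: 'a assume t: "0 < t" "t < 1"
    show "support_fun K ((1 - t) *\<^sub>R x + t *\<^sub>R y) \<le> (1 - t) * support_fun K x + t * support_fun K y"
    proof (rule support_fun_le[OF assms(2)])
      fix z assume z: "z \<in> K"
      show "((1 - t) *\<^sub>R x + t *\<^sub>R y) \<bullet> z \<le> (1 - t) * support_fun K x + t * support_fun K y"
        using t support_fun_ge[OF assms(1) z] by (simp add: inner_add_left add_mono mult_left_mono)
    qed
  qed simp
  then have "continuous_on UNIV (support_fun K)" by (intro convex_on_continuous) auto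
  then show ?thesis by (rule continuous_on_subset) simp
qed

lemma support_fun_scaleR:
  assumes "compact K" "K \<noteq> {}" "0 < c"
  shows "support_fun ((\<lambda>x. c *\<^sub>R x) ` K) v = c * support_fun K v"
proof (rule antisym)
  show "support_fun ((\<lambda>x. c *\<^sub>R x) ` K) v \<le> c * support_fun K v"
    using assms by (intro support_fun_le) (auto intro: support_fun_ge)
  have "support_fun K v \<le> support_fun ((\<lambda>x. c *\<^sub>R x) ` K) v / c"
  proof (rule support_fun_le[OF assms(2)])
    fix x assume "x \<in> K"
    then have "v \<bullet> (c *\<^sub>R x) \<le> support_fun ((\<lambda>x. c *\<^sub>R x) ` K) v"
      using assms(1) by (intro support_fun_ge compact_scaling) auto
    then show "v \<bullet> x \<le> support_fun ((\<lambda>x. c *\<^sub>R x) ` K) v / c" using assms(3) by (simp add: field_simps)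
  qed
  then show "c * support_fun K v \<le> support_fun ((\<lambda>x. c *\<^sub>R x) ` K) v"
    using assms(3) by (simp add: field_simps)
qed

section \<open>Outer normals and the polar body\<close>

text \<open>
  The fibre over \<open>u\<close> of the relation behind \<^const>\<open>reverse_radial_gauss_image\<close>.
\<close>
definition outer_normals :: "'a::euclidean_space set \<Rightarrow> 'a \<Rightarrow> 'a set" where
  "outer_normals K u = {v \<in> sphere 0 1. (radial_fun K u *\<^sub>R u) \<bullet> v = support_fun K v}"

definition polar :: "'a::euclidean_space set \<Rightarrow> 'a set" where
  "polar K = {w. \<forall>x\<in>K. w \<bullet> x \<le> 1}"

lemma compact_polar:
  assumes "0 \<in> interior K"
  shows "compact (polar K)"
proof -
  obtain d where d: "0 < d" "cball 0 d \<subseteq> K" using assms by (auto simp: mem_interior_cball)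
  have "norm w \<le> 1 / d" if "w \<in> polar K" for w
  proof (cases "w = 0")
    case False
    have "d *\<^sub>R sgn w \<in> K" using d by (auto simp: norm_sgn intro!: subsetD[OF d(2)])
    then have "w \<bullet> (d *\<^sub>R sgn w) \<le> 1" using that unfolding polar_def by blast
    moreover have "w \<bullet> sgn w = norm w"
      using False by (simp add: sgn_div_norm divide_simps flip: power2_norm_eq_inner) (simp add: power2_eq_square)
    ultimately show ?thesis using d by (simp add: field_simps)
  qed (use d in simp)
  then have "bounded (polar K)" by (auto simp: bounded_iff)
  moreover have "polar K = (\<Inter>x\<in>K. {w. w \<bullet> x \<le> 1})" by (auto simp: polar_def)
  then have "closed (polar K)"
    by (auto intro!: closed_INT closed_Collect_le continuous_intros)
  ultimately show ?thesis by (simp add: compact_eq_bounded_closed)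
qed

context
  fixes K :: "'a::euclidean_space set"
  assumes K: "K \<in> convex_bodies_o"
begin

lemma convex_body_props:
  shows "compact K" "convex K" "0 \<in> interior K" "K \<noteq> {}" "star_shaped_body K"
  using K star_shaped_body_convex[OF K] interior_subset[of K] unfolding convex_bodies_o_def by blast+

text \<open>
  The radial boundary point is not interior, so it has a supporting hyperplane.
\<close>
lemma outer_normals_nonempty:
  assumes "norm u = 1"
  shows "outer_normals K u \<noteq> {}"
proof -
  note K' = convex_body_props
  let ?\<rho> = "radial_fun K u"
  let ?x = "?\<rho> *\<^sub>R u"
  have "?x \<notin> interior K"
  proof
    assume "?x \<in> interior K"
    then obtain d where d: "0 < d" "cball ?x d \<subseteq> K" by (auto simp: mem_interior_cball)
    have "(?\<rho> + d) *\<^sub>R u \<in> cball ?x d"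
      using assms d by (simp add: dist_norm scaleR_left_distrib)
    then have "?\<rho> + d \<le> ?\<rho>"
      using d radial_fun_pos[OF K'(5) assms] by (intro radial_fun_ge[OF K'(5) assms]) auto
    then show False using d by simp
  qed
  moreover have "rel_interior K = interior K"
    using K'(3) by (intro rel_interior_nonempty_interior) blast
  moreover have x: "?x \<in> K" by (rule radial_fun_mem[OF K'(5) assms])
  ultimately obtain a where a: "a \<noteq> 0" "\<And>y. y \<in> K \<Longrightarrow> a \<bullet> ?x \<le> a \<bullet> y"
    using supporting_hyperplane_rel_boundary[OF K'(2), of ?x] by metis
  define v where "v = - sgn a"
  have "v \<bullet> y \<le> v \<bullet> ?x" if "y \<in> K" for y
    using a(1) a(2)[OF that] by (simp add: v_def sgn_div_norm divide_right_mono)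
  then have "support_fun K v = v \<bullet> ?x"
    using K' x by (intro antisym support_fun_le support_fun_ge) auto
  moreover have "norm v = 1" using a by (simp add: v_def norm_sgn)
  ultimately have "v \<in> outer_normals K u" by (simp add: outer_normals_def inner_commute)
  then show ?thesis by blast
qed

text \<open>
  This translates normals into maximisers: scaling an outer normal to support value \<open>1\<close> moves it into
  the polar body, and the point \<open>radial_fun K u *\<^sub>R u\<close> of \<open>K\<close> bounds all functionals in the polar
  body by the value that the scaled normal attains.
\<close>
lemma normal_scaled_maximises_polar:
  assumes u: "norm u = 1" and v: "v \<in> outer_normals K u"
  shows "(1 / support_fun K v) *\<^sub>R v \<in> linear_maximisers (polar K) u"
    and "((1 / support_fun K v) *\<^sub>R v) \<bullet> u = 1 / radial_fun K u"
proof -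
  note K' = convex_body_props
  let ?\<rho> = "radial_fun K u" and ?w = "(1 / support_fun K v) *\<^sub>R v"
  have \<rho>: "0 < ?\<rho>" by (rule radial_fun_pos[OF K'(5) u])
  have v1: "norm v = 1" and eq: "?\<rho> * (u \<bullet> v) = support_fun K v"
    using v by (auto simp: outer_normals_def)
  have h: "0 < support_fun K v" using v1 by (intro support_fun_pos K') auto
  show 1: "?w \<bullet> u = 1 / ?\<rho>"
    using h \<rho> eq by (simp add: field_simps inner_commute)
  have "?w \<in> polar K"
    using h support_fun_ge[OF K'(1), of _ v] by (auto simp: polar_def field_simps)
  moreover have "w' \<bullet> u \<le> ?w \<bullet> u" if "w' \<in> polar K" for w'
  proof -
    have "w' \<bullet> (?\<rho> *\<^sub>R u) \<le> 1"
      using that radial_fun_mem[OF K'(5) u] unfolding polar_def by blast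
    then show ?thesis using \<rho> unfolding 1 by (simp add: field_simps)
  qed
  ultimately show "?w \<in> linear_maximisers (polar K) u" by (simp add: linear_maximisers_def)
qed

text \<open>
  The classical duality between radial and support functions. It yields continuity of the radial
  function of a convex body, because support functions are finite and convex.
\<close>
lemma radial_fun_eq_support_polar:
  assumes "norm u = 1"
  shows "radial_fun K u = 1 / support_fun (polar K) u"
proof -
  obtain v where v: "v \<in> outer_normals K u" using outer_normals_nonempty[OF assms] by blast
  let ?w = "(1 / support_fun K v) *\<^sub>R v"
  have w: "?w \<in> polar K" "\<And>w'. w' \<in> polar K \<Longrightarrow> w' \<bullet> u \<le> ?w \<bullet> u"
    using normal_scaled_maximises_polar(1)[OF assms v] by (auto simp: linear_maximisers_def)
  have "support_fun (polar K) u = ?w \<bullet> u"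
    using w support_fun_ge[OF compact_polar[OF convex_body_props(3)] w(1), of u]
    by (intro antisym support_fun_le) (auto simp: inner_commute)
  then show ?thesis using normal_scaled_maximises_polar(2)[OF assms v] by simp
qed

lemma continuous_on_radial_fun: "continuous_on (sphere 0 1) (radial_fun K)"
proof -
  have pos: "0 < support_fun (polar K) u" if "norm u = 1" for u
    using radial_fun_pos[OF convex_body_props(5) that] radial_fun_eq_support_polar[OF that] by simp
  have ne: "polar K \<noteq> {}" by (auto simp: polar_def intro!: exI[of _ 0])
  have "continuous_on (sphere 0 1) (\<lambda>u. 1 / support_fun (polar K) u)"
    using pos by (intro continuous_intros continuous_on_support_fun compact_polar convex_body_props ne)
      (force dest: pos)
  then show ?thesis
    by (rule continuous_on_eq) (simp add: radial_fun_eq_support_polar)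
qed

text \<open>
  Unit vectors are recovered from their positive multiples, so distinct normals stay distinct when
  they are scaled into the polar body.
\<close>
lemma distinct_normals_imp_distinct_maximisers:
  assumes u: "norm u = 1" and v: "v \<in> outer_normals K u" "v' \<in> outer_normals K u" "v \<noteq> v'"
  shows "\<exists>w w'. w \<in> linear_maximisers (polar K) u \<and> w' \<in> linear_maximisers (polar K) u \<and> w \<noteq> w'"
proof -
  let ?w = "(1 / support_fun K v) *\<^sub>R v" and ?w' = "(1 / support_fun K v') *\<^sub>R v'"
  have n: "norm v = 1" "norm v' = 1" using v by (auto simp: outer_normals_def)
  have h: "0 < support_fun K v" "0 < support_fun K v'"
    using n by (auto intro!: support_fun_pos convex_body_props)
  have "v = v'" if "?w = ?w'"
  proof -
    have "sgn v = sgn v'" using arg_cong[OF that, of sgn] h by (simp add: sgn_scaleR)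
    then show ?thesis using n by (simp add: sgn_div_norm)
  qed
  then show ?thesis using normal_scaled_maximises_polar(1)[OF u] v by blast
qed

lemma closed_reverse_radial_gauss_image:
  assumes "closed \<eta>" "\<eta> \<subseteq> sphere 0 1"
  shows "closed (reverse_radial_gauss_image K \<eta>)"
proof -
  let ?T = "{z \<in> \<eta> \<times> sphere 0 1. (radial_fun K (snd z) *\<^sub>R snd z) \<bullet> fst z = support_fun K (fst z)}"
  have "compact \<eta>" using assms bounded_subset[OF bounded_sphere] by (simp add: compact_eq_bounded_closed)
  have "continuous_on (\<eta> \<times> sphere 0 1) (\<lambda>z. radial_fun K (snd z))"
    by (rule continuous_on_compose2[OF continuous_on_radial_fun continuous_on_snd[OF continuous_on_id]]) auto
  moreover have "continuous_on (\<eta> \<times> sphere 0 1) (\<lambda>z. support_fun K (fst z))"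
    using convex_body_props
    by (intro continuous_on_compose2[OF continuous_on_support_fun[where T = UNIV] continuous_on_fst[OF continuous_on_id]] subset_UNIV)
  ultimately have cts: "continuous_on (\<eta> \<times> sphere 0 1)
      (\<lambda>z. (radial_fun K (snd z) *\<^sub>R snd z) \<bullet> fst z - support_fun K (fst z))"
    by (intro continuous_intros)
  have "closed ((\<eta> \<times> sphere 0 1) \<inter>
      (\<lambda>z. (radial_fun K (snd z) *\<^sub>R snd z) \<bullet> fst z - support_fun K (fst z)) -` {0})"
    by (rule continuous_closed_preimage[OF cts closed_Times[OF assms(1) closed_sphere] closed_singleton])
  also have "(\<eta> \<times> sphere 0 1) \<inter>
      (\<lambda>z. (radial_fun K (snd z) *\<^sub>R snd z) \<bullet> fst z - support_fun K (fst z)) -` {0} = ?T"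
    by (simp only: vimage_def Int_def mem_Collect_eq singleton_iff right_minus_eq)
  finally have "closed {u. \<exists>v. v \<in> \<eta> \<and> (v, u) \<in> ?T}"
    by (rule closed_compact_projection[OF \<open>compact \<eta>\<close>])
  also have "{u. \<exists>v. v \<in> \<eta> \<and> (v, u) \<in> ?T} = reverse_radial_gauss_image K \<eta>"
    unfolding reverse_radial_gauss_image_def mem_Collect_eq mem_Times_iff fst_conv snd_conv by blast
  finally show ?thesis .
qed

end

section \<open>Spherical Lebesgue measure\<close>

lemma space_spherical_lebesgue [simp]: "space spherical_lebesgue = sphere 0 1"
  by (simp add: spherical_lebesgue_def space_scale_measure space_restrict_space)

lemma sets_spherical_lebesgueI:
  fixes A :: "'a::euclidean_space set"
  assumes "A \<in> sets borel"
  shows "A \<inter> sphere 0 1 \<in> sets spherical_lebesgue"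
proof -
  have "A \<inter> sphere 0 1 \<in> sets (restrict_space borel (sphere 0 1))"
    using assms by (subst sets_restrict_space_iff) (auto intro: sets.Int)
  then show ?thesis
    unfolding spherical_lebesgue_def by (intro sets_completionI_sets) simp
qed

lemma borel_measurable_spherical_lebesgue:
  fixes f :: "'a::euclidean_space \<Rightarrow> real"
  assumes "continuous_on (sphere 0 1) f"
  shows "f \<in> borel_measurable spherical_lebesgue"
proof -
  have "sets (spherical_lebesgue :: 'a measure) \<supseteq> sets (restrict_space borel (sphere 0 1))"
    unfolding spherical_lebesgue_def by (auto intro!: sets_completionI_sets)
  then have "measurable (restrict_space borel (sphere 0 1)) borel \<subseteq> borel_measurable (spherical_lebesgue :: 'a measure)"
    by (intro measurable_mono) (auto simp: space_restrict_space)
  then show ?thesis using borel_measurable_continuous_on_restrict[OF assms] by blast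
qed

lemma finite_measure_spherical_lebesgue: "finite_measure (spherical_lebesgue :: 'a::euclidean_space measure)"
proof
  have "emeasure (spherical_lebesgue :: 'a measure) (sphere 0 1) \<le> of_nat DIM('a) * emeasure lborel (ball (0::'a) 1)"
    by (subst emeasure_spherical_lebesgue) (auto intro!: mult_left_mono emeasure_mono)
  also have "\<dots> < \<infinity>"
    using emeasure_bounded_finite[of "ball (0::'a) 1"] by (simp add: ennreal_mult_less_top of_nat_less_top)
  finally show "emeasure (spherical_lebesgue :: 'a measure) (space spherical_lebesgue) \<noteq> \<infinity>" by simp
qed

text \<open>
  The cone over a relatively open set, without the origin, is open.
\<close>
lemma spherical_lebesgue_open_pos:
  fixes U :: "'a::euclidean_space set"
  assumes "open U" "u \<in> U" "norm u = 1"
  shows "0 < emeasure spherical_lebesgue (U \<inter> sphere 0 1)"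
proof -
  let ?C = "{r *\<^sub>R v | r v. 0 < r \<and> r < 1 \<and> v \<in> U \<inter> sphere 0 1}"
  have cone: "?C = (ball 0 1 - {0}) \<inter> sgn -` U"
  proof (intro equalityI subsetI)
    fix x assume "x \<in> ?C"
    then obtain r v where "x = r *\<^sub>R v" "0 < r" "r < 1" "v \<in> U" "norm v = 1" by auto
    then show "x \<in> (ball 0 1 - {0}) \<inter> sgn -` U" by (auto simp: sgn_scaleR) (simp add: sgn_div_norm)
  next
    fix x assume "x \<in> (ball 0 1 - {0}) \<inter> sgn -` U"
    then have "x = norm x *\<^sub>R sgn x" "0 < norm x" "norm x < 1" "sgn x \<in> U \<inter> sphere 0 1"
      by (auto simp: sgn_div_norm)
    then show "x \<in> ?C" by blast
  qed
  have "continuous_on (ball 0 1 - {0::'a}) sgn"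
    unfolding sgn_div_norm by (intro continuous_intros) auto
  then have "open ?C" unfolding cone using assms(1) by (intro continuous_open_preimage) auto
  moreover have "(1 / 2) *\<^sub>R u \<in> ?C"
    using assms by (intro CollectI exI[of _ "1/2"] exI[of _ u]) auto
  ultimately have "emeasure lborel ?C \<noteq> 0"
    using open_not_negligible[of ?C] by (auto simp: negligible_iff_null_sets null_sets_def)
  then show ?thesis
    using assms(1) by (subst emeasure_spherical_lebesgue) (auto simp: zero_less_iff_neq_zero)
qed

text \<open>
  A point where \<open>f\<close> differs from \<open>c\<close> has a neighbourhood in the sphere of positive measure with the
  same property.
\<close>
lemma AE_sphere_imp_all:
  fixes f :: "'a::euclidean_space \<Rightarrow> real"
  assumes cts: "continuous_on (sphere 0 1) f" and ae: "AE u in spherical_lebesgue. f u = c" and u: "norm u = 1"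
  shows "f u = c"
proof (rule ccontr)
  assume "f u \<noteq> c"
  have "\<exists>U. open U \<and> U \<inter> sphere 0 1 = f -` (- {c}) \<inter> sphere 0 1"
    using cts unfolding continuous_on_open_invariant by (rule allE[of _ "- {c}"]) (simp add: open_Compl)
  then obtain U where U: "open U" "U \<inter> sphere 0 1 = f -` (- {c}) \<inter> sphere 0 1" by (elim exE conjE)
  have U_iff: "v \<in> U \<longleftrightarrow> f v \<noteq> c" if "norm v = 1" for v
    using arg_cong[OF U(2), of "\<lambda>S. v \<in> S"] that by simp
  have "u \<in> U" using U_iff[OF u] \<open>f u \<noteq> c\<close> by simp
  have "AE v in spherical_lebesgue. v \<notin> U \<inter> sphere 0 1"
    using ae by (rule AE_mp) (intro AE_I2 impI, simp add: U_iff)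
  moreover have "U \<inter> sphere 0 1 \<in> sets spherical_lebesgue"
    using U(1) by (intro sets_spherical_lebesgueI borel_open)
  ultimately have "U \<inter> sphere 0 1 \<in> null_sets spherical_lebesgue" using AE_iff_null_sets by blast
  then have "emeasure spherical_lebesgue (U \<inter> sphere 0 1) = 0" by (rule null_setsD1)
  then show False using spherical_lebesgue_open_pos[OF U(1) \<open>u \<in> U\<close> u] by simp
qed

text \<open>
  For a set that is closed under positive scaling, the cone that defines the spherical measure lies
  in the set itself.
\<close>
lemma AE_spherical_lebesgue_notin_null_cone:
  fixes N :: "'a::euclidean_space set"
  assumes N: "N \<in> null_sets lborel" and cone: "\<And>x r. \<lbrakk>x \<in> N; 0 < r\<rbrakk> \<Longrightarrow> r *\<^sub>R x \<in> N"
  shows "AE u in spherical_lebesgue. u \<notin> N"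
proof -
  have D: "N \<inter> sphere 0 1 \<in> sets borel" using N by (auto simp: null_sets_def)
  have "emeasure lborel {r *\<^sub>R u | r u. 0 < r \<and> r < 1 \<and> u \<in> N \<inter> sphere 0 1} \<le> emeasure lborel N"
    using N cone by (intro emeasure_mono) auto
  then have "emeasure spherical_lebesgue (N \<inter> sphere 0 1) = 0"
    using N by (subst emeasure_spherical_lebesgue[OF D]) auto
  moreover have "N \<inter> sphere 0 1 \<in> sets spherical_lebesgue"
    using N by (intro sets_spherical_lebesgueI) (auto simp: null_sets_def)
  ultimately have "N \<inter> sphere 0 1 \<in> null_sets spherical_lebesgue" by (simp add: null_sets_def)
  then have "AE u in spherical_lebesgue. u \<notin> N \<inter> sphere 0 1" by (rule AE_not_in)
  then show ?thesis by (rule AE_mp) (auto intro!: AE_I2)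
qed

text \<open>
  The set of directions with several maximisers over the polar body is a null cone.
\<close>
lemma outer_normals_unique_AE:
  fixes K :: "'a::euclidean_space set"
  assumes K: "K \<in> convex_bodies_o"
  shows "AE u in spherical_lebesgue. \<forall>v\<in>outer_normals K u. \<forall>v'\<in>outer_normals K u. v = v'"
proof -
  let ?N = "{x. \<exists>w\<in>linear_maximisers (polar K) x. \<exists>w'\<in>linear_maximisers (polar K) x. w \<noteq> w'}"
  have "AE u in spherical_lebesgue. u \<notin> ?N"
    using K by (intro AE_spherical_lebesgue_notin_null_cone nonunique_linear_maximisers_null compact_polar)
      (auto simp: linear_maximisers_scaleR convex_bodies_o_def)
  then show ?thesis
  proof (rule AE_mp, intro AE_I2 impI ballI)
    fix u v v' assume "u \<in> space spherical_lebesgue" "u \<notin> ?N" and v: "v \<in> outer_normals K u" "v' \<in> outer_normals K u"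
    then show "v = v'" using distinct_normals_imp_distinct_maximisers[OF K _ v] by force
  qed
qed

lemma convex_body_imp_star_body: "K \<in> convex_bodies_o \<Longrightarrow> K \<in> star_bodies_o"
  using continuous_on_radial_fun[of K] star_shaped_body_convex[of K]
  by (simp add: star_bodies_o_def star_shaped_body_def)

lemma support_fun_body_pos: "L \<in> convex_bodies_o \<Longrightarrow> norm v = 1 \<Longrightarrow> 0 < support_fun L v"
  by (rule support_fun_pos) (auto simp: convex_bodies_o_def)

lemma exists_bound_on_sphere:
  fixes f :: "'a::euclidean_space \<Rightarrow> real"
  assumes "continuous_on (sphere 0 1) f"
  shows "\<exists>B. \<forall>u\<in>sphere 0 1. norm (f u) \<le> B"
  using compact_imp_bounded[OF compact_continuous_image[OF assms compact_sphere]]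
  by (auto simp: bounded_iff)

lemma integrable_spherical_lebesgue:
  fixes f :: "'a::euclidean_space \<Rightarrow> real"
  assumes "continuous_on (sphere 0 1) f"
  shows "integrable spherical_lebesgue f"
proof -
  obtain B where "\<And>u. u \<in> sphere 0 1 \<Longrightarrow> norm (f u) \<le> B"
    using exists_bound_on_sphere[OF assms] by blast
  then show ?thesis
    by (intro finite_measure.integrable_const_bound[OF finite_measure_spherical_lebesgue, of _ B]
        borel_measurable_spherical_lebesgue[OF assms] AE_I2) auto
qed

section \<open>The radial Gauss map\<close>

text \<open>
  An arbitrary selection of outer normals, the radial Gauss map wherever the normal is unique. Pointwise
  inequalities hold for it in every direction; uniqueness of normals matters only for measurability
  and for the change of variables.
\<close>
definition outer_normal :: "'a::euclidean_space set \<Rightarrow> 'a \<Rightarrow> 'a" where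
  "outer_normal K u = (SOME v. v \<in> outer_normals K u)"

lemma outer_normal_mem:
  assumes "K \<in> convex_bodies_o" "norm u = 1"
  shows "outer_normal K u \<in> outer_normals K u"
  using outer_normals_nonempty[OF assms] unfolding outer_normal_def by (simp add: some_in_eq)

lemma norm_outer_normal: "K \<in> convex_bodies_o \<Longrightarrow> norm u = 1 \<Longrightarrow> norm (outer_normal K u) = 1"
  using outer_normal_mem[of K u] by (simp add: outer_normals_def)

lemma reverse_radial_gauss_image_AE:
  assumes K: "K \<in> convex_bodies_o" and \<eta>: "\<eta> \<subseteq> sphere 0 1"
  shows "AE u in spherical_lebesgue. u \<in> reverse_radial_gauss_image K \<eta> \<longleftrightarrow> outer_normal K u \<in> \<eta>"
  using outer_normals_unique_AE[OF K]
proof (rule AE_mp, intro AE_I2 impI)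
  fix u assume "u \<in> space spherical_lebesgue"
    and unique: "\<forall>v\<in>outer_normals K u. \<forall>v'\<in>outer_normals K u. v = v'"
  then have u: "norm u = 1" "u \<in> sphere 0 1" by simp_all
  have "u \<in> reverse_radial_gauss_image K \<eta> \<longleftrightarrow> outer_normals K u \<inter> \<eta> \<noteq> {}"
    using u(2) \<eta> unfolding reverse_radial_gauss_image_def outer_normals_def by blast
  also have "outer_normals K u = {outer_normal K u}"
    using unique outer_normal_mem[OF K u(1)] by blast
  finally show "u \<in> reverse_radial_gauss_image K \<eta> \<longleftrightarrow> outer_normal K u \<in> \<eta>" by simp
qed

lemma sets_spherical_lebesgue_AE:
  assumes "AE u in spherical_lebesgue. u \<in> A \<longleftrightarrow> u \<in> B" "A \<in> sets spherical_lebesgue" "B \<subseteq> sphere 0 1"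
  shows "B \<in> sets spherical_lebesgue"
proof -
  have "B \<subseteq> space spherical_lebesgue" using assms(3) by simp
  then show ?thesis
    using assms(1,2) unfolding spherical_lebesgue_def by (rule completion.in_sets_AE[rotated -1])
qed

abbreviation sphere_borel :: "'a::euclidean_space measure" where
  "sphere_borel \<equiv> restrict_space borel (sphere 0 1)"

text \<open>
  The preimage of a closed set differs from its closed reverse radial Gauss image only where normals
  are not unique, that is, by a null set. Completeness of the spherical measure makes the preimage
  measurable.
\<close>
lemma outer_normal_measurable:
  fixes K :: "'a::euclidean_space set"
  assumes K: "K \<in> convex_bodies_o"
  shows "outer_normal K \<in> measurable spherical_lebesgue sphere_borel"
proof (rule measurable_restrict_space2)
  show "outer_normal K \<in> space spherical_lebesgue \<rightarrow> sphere 0 1"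
    using norm_outer_normal[OF K] by simp
  show "outer_normal K \<in> borel_measurable spherical_lebesgue"
  proof (rule borel_measurableI)
    fix U :: "'a set" assume "open U"
    let ?\<eta> = "sphere 0 1 - U"
    have "closed (reverse_radial_gauss_image K ?\<eta>)"
      using \<open>open U\<close> by (intro closed_reverse_radial_gauss_image K closed_Diff) auto
    then have image: "reverse_radial_gauss_image K ?\<eta> \<inter> sphere 0 1 \<in> sets spherical_lebesgue"
      by (intro sets_spherical_lebesgueI borel_closed)
    have ae: "AE u in spherical_lebesgue. u \<in> reverse_radial_gauss_image K ?\<eta> \<inter> sphere 0 1
        \<longleftrightarrow> u \<in> outer_normal K -` ?\<eta> \<inter> sphere 0 1"
      by (rule AE_mp[OF reverse_radial_gauss_image_AE[OF K, of ?\<eta>]]) auto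
    have "outer_normal K -` ?\<eta> \<inter> sphere 0 1 \<in> sets spherical_lebesgue"
      by (rule sets_spherical_lebesgue_AE[OF ae image]) simp
    then have "space spherical_lebesgue - (outer_normal K -` ?\<eta> \<inter> sphere 0 1) \<in> sets spherical_lebesgue"
      by (rule sets.compl_sets)
    also have "space spherical_lebesgue - (outer_normal K -` ?\<eta> \<inter> sphere 0 1) =
        outer_normal K -` U \<inter> space spherical_lebesgue"
      using norm_outer_normal[OF K] by auto
    finally show "outer_normal K -` U \<inter> space spherical_lebesgue \<in> sets spherical_lebesgue" .
  qed
qed

lemma reverse_radial_gauss_image_measurable:
  assumes K: "K \<in> convex_bodies_o" and \<eta>: "\<eta> \<in> sets sphere_borel"
  shows "reverse_radial_gauss_image K \<eta> \<in> sets spherical_lebesgue"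
proof (rule sets_spherical_lebesgue_AE)
  have sub: "\<eta> \<subseteq> sphere 0 1" using sets.sets_into_space[OF \<eta>] by (simp add: space_restrict_space)
  show "outer_normal K -` \<eta> \<inter> sphere 0 1 \<in> sets spherical_lebesgue"
    using measurable_sets[OF outer_normal_measurable[OF K] \<eta>] by simp
  show "AE u in spherical_lebesgue. u \<in> outer_normal K -` \<eta> \<inter> sphere 0 1 \<longleftrightarrow> u \<in> reverse_radial_gauss_image K \<eta>"
    by (rule AE_mp[OF reverse_radial_gauss_image_AE[OF K sub]]) (auto intro!: AE_I2)
  show "reverse_radial_gauss_image K \<eta> \<subseteq> sphere 0 1"
    by (auto simp: reverse_radial_gauss_image_def)
qed

section \<open>Dual mixed volumes as integrals over one measure\<close>

definition dual_volume_density :: "real \<Rightarrow> 'a::euclidean_space set \<Rightarrow> 'a set \<Rightarrow> 'a \<Rightarrow> real" where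
  "dual_volume_density q K Q u = radial_fun K u powr q * radial_fun Q u powr (real DIM('a) - q) / real DIM('a)"

text \<open>
  The spherical measure weighted so that its total mass is the dual mixed volume of \<open>K\<close> and \<open>Q\<close>; all
  three quantities of the inequality become integrals with respect to it.
\<close>
definition dual_volume_measure :: "real \<Rightarrow> 'a::euclidean_space set \<Rightarrow> 'a set \<Rightarrow> 'a measure" where
  "dual_volume_measure q K Q = density spherical_lebesgue (\<lambda>u. ennreal (dual_volume_density q K Q u))"

lemma star_body_radial:
  assumes "Q \<in> star_bodies_o"
  shows "continuous_on (sphere 0 1) (radial_fun Q)" "norm u = 1 \<Longrightarrow> 0 < radial_fun Q u"
  using assms radial_fun_pos[OF star_shaped_body_star[OF assms]] by (auto simp: star_bodies_o_def)

context
  fixes q :: real and K Q :: "'a::euclidean_space set"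
  assumes K: "K \<in> convex_bodies_o" and Q: "Q \<in> star_bodies_o"
begin

lemma dual_volume_density_pos: "norm u = 1 \<Longrightarrow> 0 < dual_volume_density q K Q u"
  using star_body_radial(2)[OF Q, of u] star_body_radial(2)[OF convex_body_imp_star_body[OF K], of u]
  by (simp add: dual_volume_density_def)

lemma dual_volume_density_nonneg: "0 \<le> dual_volume_density q K Q u"
  by (simp add: dual_volume_density_def)

lemma continuous_on_dual_volume_density: "continuous_on (sphere 0 1) (dual_volume_density q K Q)"
  unfolding dual_volume_density_def
  using star_body_radial(2)[OF Q] star_body_radial(2)[OF convex_body_imp_star_body[OF K]]
  by (intro continuous_intros star_body_radial(1) Q convex_body_imp_star_body[OF K]) force+

lemmas dual_volume_density_measurable =
  borel_measurable_spherical_lebesgue[OF continuous_on_dual_volume_density]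

lemma space_dual_volume_measure: "space (dual_volume_measure q K Q) = sphere 0 1"
  by (simp add: dual_volume_measure_def)

lemma sets_dual_volume_measure: "sets (dual_volume_measure q K Q) = sets spherical_lebesgue"
  by (simp add: dual_volume_measure_def)

lemma integral_dual_volume_measure:
  assumes "f \<in> borel_measurable spherical_lebesgue"
  shows "(LINT u|dual_volume_measure q K Q. f u) = (LINT u|spherical_lebesgue. dual_volume_density q K Q u * f u)"
  unfolding dual_volume_measure_def
  by (subst integral_density[OF assms dual_volume_density_measurable]) (auto simp: dual_volume_density_nonneg)

lemma finite_measure_dual_volume_measure: "finite_measure (dual_volume_measure q K Q)"
proof
  have "emeasure (dual_volume_measure q K Q) (space (dual_volume_measure q K Q))
      = (\<integral>\<^sup>+ u. ennreal (dual_volume_density q K Q u) * indicator (sphere 0 1) u \<partial>spherical_lebesgue)"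
    unfolding space_dual_volume_measure unfolding dual_volume_measure_def
    using dual_volume_density_measurable sets.top[of "spherical_lebesgue :: 'a measure"]
    by (subst emeasure_density) auto
  also have "\<dots> = (\<integral>\<^sup>+ u. ennreal (dual_volume_density q K Q u) \<partial>spherical_lebesgue)"
    by (intro nn_integral_cong) simp
  also have "\<dots> = ennreal (LINT u|spherical_lebesgue. dual_volume_density q K Q u)"
    by (intro nn_integral_eq_integral integrable_spherical_lebesgue continuous_on_dual_volume_density)
      (simp add: dual_volume_density_nonneg)
  finally show "emeasure (dual_volume_measure q K Q) (space (dual_volume_measure q K Q)) \<noteq> \<infinity>" by simp
qed

lemma measure_dual_volume_measure:
  assumes "A \<in> sets spherical_lebesgue"
  shows "measure (dual_volume_measure q K Q) A =
    (LINT u|spherical_lebesgue. dual_volume_density q K Q u * indicator A u)"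
proof -
  have "measure (dual_volume_measure q K Q) A = (LINT u|dual_volume_measure q K Q. indicator A u)"
    using assms sets.sets_into_space[OF assms]
    by (simp add: space_dual_volume_measure Int_absorb2)
  also have "\<dots> = (LINT u|spherical_lebesgue. dual_volume_density q K Q u * indicator A u)"
    using assms by (intro integral_dual_volume_measure) simp
  finally show ?thesis .
qed

lemma dual_mixed_volume_eq_measure:
  "dual_mixed_volume q K Q = measure (dual_volume_measure q K Q) (sphere 0 1)"
proof -
  have "measure (dual_volume_measure q K Q) (sphere 0 1) =
      (LINT u|spherical_lebesgue. dual_volume_density q K Q u * indicator (sphere 0 1) u)"
    using sets.top[of "spherical_lebesgue :: 'a measure"] by (intro measure_dual_volume_measure) simp
  also have "\<dots> = (LINT u|spherical_lebesgue. dual_volume_density q K Q u)"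
    by (intro Bochner_Integration.integral_cong) auto
  also have "\<dots> = dual_mixed_volume q K Q"
    by (simp add: dual_mixed_volume_def dual_volume_density_def)
  finally show ?thesis by simp
qed

lemma AE_dual_volume_measure:
  "(AE u in dual_volume_measure q K Q. P u) \<longleftrightarrow> (AE u in spherical_lebesgue. P u)"
proof -
  have "(AE u in dual_volume_measure q K Q. P u) \<longleftrightarrow>
      (AE u in spherical_lebesgue. 0 < ennreal (dual_volume_density q K Q u) \<longrightarrow> P u)"
    unfolding dual_volume_measure_def using dual_volume_density_measurable by (intro AE_density) simp
  also have "\<dots> \<longleftrightarrow> (AE u in spherical_lebesgue. P u)"
    by (rule AE_cong) (simp add: dual_volume_density_pos)
  finally show ?thesis .
qed

text \<open>
  Otherwise every property would hold almost everywhere on the sphere, but a continuous function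
  that is constant almost everywhere is constant.
\<close>
lemma dual_mixed_volume_pos: "0 < dual_mixed_volume q K Q"
proof -
  interpret finite_measure "dual_volume_measure q K Q" by (rule finite_measure_dual_volume_measure)
  obtain u :: 'a where u: "norm u = 1" using norm_Basis[OF SOME_Basis] by blast
  have "sphere 0 1 \<notin> null_sets (dual_volume_measure q K Q)"
  proof
    assume "sphere 0 1 \<in> null_sets (dual_volume_measure q K Q)"
    then have "AE u in spherical_lebesgue. u \<notin> sphere (0::'a) 1"
      using AE_not_in AE_dual_volume_measure by blast
    then have "AE u::'a in spherical_lebesgue. (0::real) = 1"
      by (rule AE_mp) (auto intro!: AE_I2)
    then show False using AE_sphere_imp_all[of "\<lambda>_. 0" 1 u] u by simp
  qed
  then have "measure (dual_volume_measure q K Q) (sphere 0 1) \<noteq> 0"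
    using sets.top[of "dual_volume_measure q K Q"]
    by (auto simp: null_sets_def emeasure_eq_measure space_dual_volume_measure)
  then show ?thesis
    unfolding dual_mixed_volume_eq_measure using measure_nonneg[of "dual_volume_measure q K Q" "sphere 0 1"] by linarith
qed

lemma dual_curvature_eq_measure:
  assumes \<eta>: "\<eta> \<in> sets sphere_borel"
  shows "dual_curvature q K Q \<eta> =
    measure (dual_volume_measure q K Q) (outer_normal K -` \<eta> \<inter> sphere 0 1)"
proof -
  have sub: "\<eta> \<subseteq> sphere 0 1" using sets.sets_into_space[OF \<eta>] by (simp add: space_restrict_space)
  have A: "outer_normal K -` \<eta> \<inter> sphere 0 1 \<in> sets spherical_lebesgue"
    using measurable_sets[OF outer_normal_measurable[OF K] \<eta>] by simp
  note [measurable] = dual_volume_density_measurable A reverse_radial_gauss_image_measurable[OF K \<eta>]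
  have "measure (dual_volume_measure q K Q) (outer_normal K -` \<eta> \<inter> sphere 0 1)
      = (LINT u|spherical_lebesgue. dual_volume_density q K Q u * indicator (outer_normal K -` \<eta> \<inter> sphere 0 1) u)"
    by (rule measure_dual_volume_measure[OF A])
  also have "\<dots> = (LINT u|spherical_lebesgue. dual_volume_density q K Q u * indicator (reverse_radial_gauss_image K \<eta>) u)"
  proof (rule integral_cong_AE)
    show "AE u in spherical_lebesgue. dual_volume_density q K Q u * indicator (outer_normal K -` \<eta> \<inter> sphere 0 1) u
        = dual_volume_density q K Q u * indicator (reverse_radial_gauss_image K \<eta>) u"
      by (rule AE_mp[OF reverse_radial_gauss_image_AE[OF K sub]]) (auto intro!: AE_I2 simp: indicator_def)
  qed measurable
  also have "\<dots> = (LINT u|spherical_lebesgue. 1 / real DIM('a) * (indicator (reverse_radial_gauss_image K \<eta>) u *\<^sub>R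
        (radial_fun K u powr q * radial_fun Q u powr (real DIM('a) - q))))"
    by (intro Bochner_Integration.integral_cong) (auto simp: dual_volume_density_def)
  also have "\<dots> = dual_curvature q K Q \<eta>"
    unfolding dual_curvature_def set_lebesgue_integral_def by (rule integral_mult_right_zero)
  finally show ?thesis by simp
qed

text \<open>
  The dual curvature measure is the image of the weighted spherical measure under the radial Gauss
  map. In particular the set function is countably additive, so that \<^const>\<open>measure_of\<close> does
  not return the null measure.
\<close>
lemma dual_curvature_measure_eq_distr:
  "dual_curvature_measure q K Q = distr (dual_volume_measure q K Q) sphere_borel (outer_normal K)"
    (is "_ = ?D")
proof -
  interpret finite_measure "dual_volume_measure q K Q" by (rule finite_measure_dual_volume_measure)
  have meas: "outer_normal K \<in> measurable (dual_volume_measure q K Q) sphere_borel"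
    using outer_normal_measurable[OF K] by (simp add: measurable_def space_dual_volume_measure sets_dual_volume_measure)
  have sigma: "sigma_sets (sphere 0 1) (sets sphere_borel) = sets (sphere_borel :: 'a measure)"
    using sets.sigma_sets_eq[of "sphere_borel :: 'a measure"] by (simp add: space_restrict_space)
  have "dual_curvature_measure q K Q = measure_of (sphere 0 1) (sets sphere_borel) (emeasure ?D)"
    unfolding dual_curvature_measure_def
  proof (rule measure_of_eq)
    show "sets sphere_borel \<subseteq> Pow (sphere (0::'a) 1)"
      using sets.space_closed[of "sphere_borel :: 'a measure"] by (simp add: space_restrict_space)
    fix \<eta> :: "'a set" assume "\<eta> \<in> sigma_sets (sphere 0 1) (sets sphere_borel)"
    then have \<eta>: "\<eta> \<in> sets sphere_borel" unfolding sigma .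
    show "ennreal (dual_curvature q K Q \<eta>) = emeasure ?D \<eta>"
      by (simp add: dual_curvature_eq_measure[OF \<eta>] emeasure_distr[OF meas \<eta>] emeasure_eq_measure space_dual_volume_measure)
  qed
  also have "\<dots> = measure_of (space ?D) (sets ?D) (emeasure ?D)"
    by (simp add: space_restrict_space)
  also have "\<dots> = ?D" by (rule measure_of_of_measure)
  finally show ?thesis .
qed

lemma continuous_on_support_ratio_powr:
  assumes L: "L \<in> convex_bodies_o"
  shows "continuous_on (sphere 0 1) (\<lambda>v. (support_fun L v / support_fun K v) powr p)"
proof -
  have "support_fun L v / support_fun K v \<noteq> 0" "support_fun K v \<noteq> 0" if "v \<in> sphere 0 1" for v
    using support_fun_body_pos[OF K, of v] support_fun_body_pos[OF L, of v] that by auto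
  then show ?thesis
    by (intro continuous_intros continuous_on_support_fun convex_body_props K L) auto
qed

lemma integrable_comp_outer_normal:
  fixes F :: "'a \<Rightarrow> real"
  assumes F: "continuous_on (sphere 0 1) F"
  shows "integrable (dual_volume_measure q K Q) (\<lambda>u. F (outer_normal K u))"
proof -
  obtain B where B: "\<And>v. v \<in> sphere 0 1 \<Longrightarrow> norm (F v) \<le> B"
    using exists_bound_on_sphere[OF F] by blast
  have "(\<lambda>u. F (outer_normal K u)) \<in> borel_measurable (dual_volume_measure q K Q)"
    using measurable_compose[OF outer_normal_measurable[OF K] borel_measurable_continuous_on_restrict[OF F]]
    by (simp add: dual_volume_measure_def)
  then show ?thesis
    using B norm_outer_normal[OF K]
    by (intro finite_measure.integrable_const_bound[OF finite_measure_dual_volume_measure, of _ B] AE_I2)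
      (auto simp: space_dual_volume_measure)
qed

lemma integrable_dual_volume_measure:
  fixes F :: "'a \<Rightarrow> real"
  assumes F: "continuous_on (sphere 0 1) F"
  shows "integrable (dual_volume_measure q K Q) F"
proof -
  obtain B where B: "\<And>v. v \<in> sphere 0 1 \<Longrightarrow> norm (F v) \<le> B"
    using exists_bound_on_sphere[OF F] by blast
  then show ?thesis
    using borel_measurable_spherical_lebesgue[OF F]
    by (intro finite_measure.integrable_const_bound[OF finite_measure_dual_volume_measure, of _ B] AE_I2)
      (auto simp: space_dual_volume_measure dual_volume_measure_def)
qed

text \<open>
  Pulling the integral back along the radial Gauss map replaces \<open>v\<close> by the normal in direction \<open>u\<close>.
\<close>
lemma Lp_dual_mixed_volume_eq_integral:
  assumes L: "L \<in> convex_bodies_o"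
  shows "Lp_dual_mixed_volume p q K L Q =
    (LINT u|dual_volume_measure q K Q. (support_fun L (outer_normal K u) / support_fun K (outer_normal K u)) powr p)"
proof -
  let ?D = "distr (dual_volume_measure q K Q) sphere_borel (outer_normal K)"
  have sf: "(\<lambda>v. support_fun M v powr r) \<in> borel_measurable (sphere_borel :: 'a measure)" if M: "M \<in> convex_bodies_o" for M r
    using support_fun_body_pos[OF M]
    by (intro borel_measurable_continuous_on_restrict continuous_intros continuous_on_support_fun convex_body_props M) force
  have meas: "outer_normal K \<in> measurable (dual_volume_measure q K Q) sphere_borel"
    using outer_normal_measurable[OF K] by (simp add: measurable_def space_dual_volume_measure sets_dual_volume_measure)
  have "Lp_dual_mixed_volume p q K L Q =
      (LINT v|density ?D (\<lambda>v. ennreal (support_fun K v powr (- p))). support_fun L v powr p)"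
    by (simp add: Lp_dual_mixed_volume_def Lp_dual_curvature_measure_def dual_curvature_measure_eq_distr)
  also have "\<dots> = (LINT v|?D. support_fun K v powr (- p) *\<^sub>R support_fun L v powr p)"
    using sf[OF K] sf[OF L] by (intro integral_density) auto
  also have "\<dots> = (LINT u|dual_volume_measure q K Q. support_fun K (outer_normal K u) powr (- p) *\<^sub>R support_fun L (outer_normal K u) powr p)"
    using sf[OF K] sf[OF L] by (intro integral_distr meas borel_measurable_scaleR)
  also have "\<dots> = (LINT u|dual_volume_measure q K Q. (support_fun L (outer_normal K u) / support_fun K (outer_normal K u)) powr p)"
  proof (intro Bochner_Integration.integral_cong refl)
    fix u assume "u \<in> space (dual_volume_measure q K Q)"
    then have "norm (outer_normal K u) = 1" by (simp add: space_dual_volume_measure norm_outer_normal[OF K])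
    then show "support_fun K (outer_normal K u) powr (- p) *\<^sub>R support_fun L (outer_normal K u) powr p =
        (support_fun L (outer_normal K u) / support_fun K (outer_normal K u)) powr p"
      using support_fun_body_pos[OF K] support_fun_body_pos[OF L]
      by (simp add: powr_divide powr_minus_divide less_imp_le)
  qed
  finally show ?thesis .
qed

lemma continuous_on_radial_ratio_powr:
  assumes L: "L \<in> star_bodies_o"
  shows "continuous_on (sphere 0 1) (\<lambda>u. (radial_fun L u / radial_fun K u) powr r)"
proof -
  have "radial_fun L u / radial_fun K u \<noteq> 0" "radial_fun K u \<noteq> 0" if "u \<in> sphere 0 1" for u
    using star_body_radial(2)[OF L, of u] star_body_radial(2)[OF convex_body_imp_star_body[OF K], of u] that by auto
  then show ?thesis
    by (intro continuous_intros star_body_radial(1) L convex_body_imp_star_body[OF K]) auto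
qed

lemma dual_mixed_volume_eq_integral:
  assumes L: "L \<in> star_bodies_o"
  shows "dual_mixed_volume q L Q =
    (LINT u|dual_volume_measure q K Q. (radial_fun L u / radial_fun K u) powr q)"
proof -
  have "(LINT u|dual_volume_measure q K Q. (radial_fun L u / radial_fun K u) powr q) =
      (LINT u|spherical_lebesgue. dual_volume_density q K Q u * (radial_fun L u / radial_fun K u) powr q)"
    by (intro integral_dual_volume_measure borel_measurable_spherical_lebesgue continuous_on_radial_ratio_powr L)
  also have "\<dots> = (LINT u|spherical_lebesgue. dual_volume_density q L Q u)"
  proof (intro Bochner_Integration.integral_cong refl)
    fix u assume "u \<in> space (spherical_lebesgue :: 'a measure)"
    then show "dual_volume_density q K Q u * (radial_fun L u / radial_fun K u) powr q = dual_volume_density q L Q u"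
      using star_body_radial(2)[OF L, of u] star_body_radial(2)[OF convex_body_imp_star_body[OF K], of u]
      by (simp add: dual_volume_density_def powr_divide)
  qed
  also have "\<dots> = dual_mixed_volume q L Q"
    by (simp add: dual_mixed_volume_def dual_volume_density_def)
  finally show ?thesis by simp
qed

end

section \<open>The inequality for dual mixed volumes\<close>

text \<open>
  The geometric heart of the inequality: at a normal \<open>v\<close> of \<open>K\<close> in direction \<open>u\<close>, the support value
  of \<open>K\<close> is exactly \<open>radial_fun K u * (u \<bullet> v)\<close>, while for \<open>L\<close> this product is only a lower bound,
  attained by the boundary point of \<open>L\<close> in direction \<open>u\<close>.
\<close>
lemma radial_ratio_le_support_ratio:
  assumes K: "K \<in> convex_bodies_o" and L: "L \<in> convex_bodies_o" and u: "norm u = 1"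
    and v: "v \<in> outer_normals K u"
  shows "radial_fun L u / radial_fun K u \<le> support_fun L v / support_fun K v"
proof -
  have v1: "norm v = 1" and eq: "support_fun K v = radial_fun K u * (u \<bullet> v)"
    using v by (auto simp: outer_normals_def)
  have h: "0 < support_fun K v" by (rule support_fun_body_pos[OF K v1])
  have r: "0 < radial_fun K u" by (rule radial_fun_pos[OF convex_body_props(5)[OF K] u])
  have "v \<bullet> (radial_fun L u *\<^sub>R u) \<le> support_fun L v"
    using convex_body_props[OF L] radial_fun_mem[OF convex_body_props(5)[OF L] u] by (intro support_fun_ge)
  then have "radial_fun L u * (u \<bullet> v) / support_fun K v \<le> support_fun L v / support_fun K v"
    using h by (intro divide_right_mono) (auto simp: inner_commute)
  moreover have "radial_fun L u * (u \<bullet> v) / support_fun K v = radial_fun L u / radial_fun K u"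
    using h r unfolding eq by (simp add: zero_less_mult_iff)
  ultimately show ?thesis by simp
qed

lemma dilates_if_radial_ratio_const:
  assumes K: "star_shaped_body K" and L: "star_shaped_body L"
    and ratio: "\<And>u. norm u = 1 \<Longrightarrow> radial_fun L u = c * radial_fun K u" and c: "0 < c"
  shows "dilates K L"
proof -
  have iff: "x \<in> K \<longleftrightarrow> c *\<^sub>R x \<in> L" for x
  proof (cases "x = 0")
    case False
    then have "radial_fun L (sgn x) = c * radial_fun K (sgn x)" by (intro ratio) (simp add: norm_sgn)
    then show ?thesis
      using c False by (simp add: mem_star_shaped_body_iff[OF K] mem_star_shaped_body_iff[OF L] sgn_scaleR)
  qed (simp add: mem_star_shaped_body_iff[OF K] mem_star_shaped_body_iff[OF L])
  have "K = (\<lambda>x. (1 / c) *\<^sub>R x) ` L"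
  proof (intro equalityI subsetI)
    fix x assume "x \<in> K"
    then show "x \<in> (\<lambda>x. (1 / c) *\<^sub>R x) ` L"
      using c iff by (intro image_eqI[of _ _ "c *\<^sub>R x"]) auto
  next
    fix x assume "x \<in> (\<lambda>x. (1 / c) *\<^sub>R x) ` L"
    then show "x \<in> K" using c by (auto simp: iff)
  qed
  then show ?thesis using c unfolding dilates_def by (intro exI[of _ "1 / c"]) auto
qed

theorem theorem3p1:
  fixes K L Q :: "'a::euclidean_space set" and p q :: real
  assumes "Q \<in> star_bodies_o" and "K \<in> convex_bodies_o" and "L \<in> convex_bodies_o"
    and "q < p" and "p \<noteq> 0" and "q \<noteq> 0"
  shows "(Lp_dual_mixed_volume p q K L Q / dual_mixed_volume q K Q) powr (1 / p)
           \<ge> (dual_mixed_volume q L Q / dual_mixed_volume q K Q) powr (1 / q)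
    \<and> ((Lp_dual_mixed_volume p q K L Q / dual_mixed_volume q K Q) powr (1 / p)
           = (dual_mixed_volume q L Q / dual_mixed_volume q K Q) powr (1 / q)
         \<longleftrightarrow> dilates K L)"
proof -
  note Q = assms(1) and K = assms(2) and L = assms(3)
  note Ls = convex_body_imp_star_body[OF L]
  note Kb = convex_body_props[OF K] and Lb = convex_body_props[OF L]
  define M where "M = dual_volume_measure q K Q"
  define f where "f u = support_fun L (outer_normal K u) / support_fun K (outer_normal K u)" for u
  define g where "g u = radial_fun L u / radial_fun K u" for u
  define A where "A = ((LINT u|M. f u powr p) / measure M (space M)) powr (1 / p)"
  define B where "B = ((LINT u|M. g u powr q) / measure M (space M)) powr (1 / q)"
  have space: "space M = sphere 0 1" by (simp add: M_def space_dual_volume_measure[OF K Q])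
  have V: "dual_mixed_volume q K Q = measure M (space M)"
    unfolding space unfolding M_def by (rule dual_mixed_volume_eq_measure[OF K Q])
  have Vpos: "0 < measure M (space M)" using dual_mixed_volume_pos[OF K Q, of q] V by simp
  have Aeq: "(Lp_dual_mixed_volume p q K L Q / dual_mixed_volume q K Q) powr (1 / p) = A"
    unfolding A_def V f_def M_def by (simp add: Lp_dual_mixed_volume_eq_integral[OF K Q L])
  have Beq: "(dual_mixed_volume q L Q / dual_mixed_volume q K Q) powr (1 / q) = B"
    unfolding B_def V g_def M_def by (simp add: dual_mixed_volume_eq_integral[OF K Q Ls])
  have gpos: "0 < g u" if "norm u = 1" for u
    using radial_fun_pos[OF Kb(5) that] radial_fun_pos[OF Lb(5) that] by (simp add: g_def)
  have gf: "g u \<le> f u" if "norm u = 1" for u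
    unfolding g_def f_def by (rule radial_ratio_le_support_ratio[OF K L that outer_normal_mem[OF K that]])
  have cts: "continuous_on (sphere 0 1) (\<lambda>u. g u powr r)" for r
    unfolding g_def by (rule continuous_on_radial_ratio_powr[OF K Q Ls])
  have fin: "finite_measure M" unfolding M_def by (rule finite_measure_dual_volume_measure[OF K Q])
  have intf: "integrable M (\<lambda>u. f u powr p)" unfolding M_def f_def
    by (rule integrable_comp_outer_normal[OF K Q continuous_on_support_ratio_powr[OF K Q L]])
  have intg: "integrable M (\<lambda>u. g u powr r)" for r
    unfolding M_def by (rule integrable_dual_volume_measure[OF K Q cts])
  note mean = powr_mean_le[OF fin Vpos assms(4-6), of g f, folded A_def B_def]
  have "B \<le> A" using gpos gf intf intg by (intro mean(1)) (auto simp: space)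
  moreover have "dilates K L" if "A = B"
  proof -
    have "AE u in M. g u = B" using gpos gf intf intg that by (intro mean(2)) (auto simp: space)
    then have ae: "AE u in spherical_lebesgue. g u = B"
      unfolding M_def AE_dual_volume_measure[OF K Q] .
    \<comment> \<open>Continuity upgrades the almost everywhere statement to every direction.\<close>
    have "continuous_on (sphere 0 1) (\<lambda>u. g u powr 1)" by (rule cts)
    then have "continuous_on (sphere 0 1) g"
      by (rule continuous_on_eq) (use gpos in \<open>auto simp: less_imp_le\<close>)
    then have gB: "g u = B" if "norm u = 1" for u using ae that by (rule AE_sphere_imp_all)
    obtain u :: 'a where u: "norm u = 1" using norm_Basis[OF SOME_Basis] by blast
    have "0 < B" using gpos[OF u] gB[OF u] by simp
    moreover have "radial_fun L u = B * radial_fun K u" if "norm u = 1" for u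
      using gB[OF that] radial_fun_pos[OF Kb(5) that] by (simp add: g_def field_simps)
    ultimately show ?thesis by (intro dilates_if_radial_ratio_const[OF Kb(5) Lb(5)])
  qed
  moreover have "A = B" if dil: "dilates K L"
  proof -
    obtain c where c: "0 < c" and KL: "K = (\<lambda>x. c *\<^sub>R x) ` L" using dil by (auto simp: dilates_def)
    have g: "g u = 1 / c" if "norm u = 1" for u
      using radial_fun_scaleR[OF Lb(5) _ that c] Kb(5) radial_fun_pos[OF Lb(5) that] by (simp add: g_def KL)
    have f: "f u = 1 / c" if "norm u = 1" for u
      using support_fun_scaleR[OF Lb(1,4) c] support_fun_body_pos[OF L norm_outer_normal[OF K that]]
      unfolding f_def by (subst (2) KL) simp
    have "(LINT u|M. f u powr p) = (LINT u|M. (1 / c) powr p)"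
      by (rule Bochner_Integration.integral_cong[OF refl]) (simp add: space f)
    moreover have "(LINT u|M. g u powr q) = (LINT u|M. (1 / c) powr q)"
      by (rule Bochner_Integration.integral_cong[OF refl]) (simp add: space g)
    ultimately show ?thesis using Vpos c assms(5,6) by (simp add: A_def B_def powr_powr)
  qed
  ultimately show ?thesis unfolding Aeq Beq by blast
qed

end
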